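(* Let $G=\mathrm{SL}(n,2)$ with $n\geq 4$. Then $G$ has an involution $t$ such that some coset $C_G(t)x$ ($x\in G$) of its centralizer consists only of elements of even order.
   Context: $\mathrm{SL}(n,2)$ denotes the special linear group of degree $n$ over the field with $2$ elements (equal to $\mathrm{PSL}(n,2)$). An involution is an element of order exactly $2$. $C_G(t)$ denotes the centralizer of $t$ in $G$, and cosets are written as $Cx=\{cx\mid c\in C\}$. *)

theory Defs
  imports
    "HOL-Algebra.Coset"
    "HOL-Algebra.Multiplicative_Group"
    "HOL-Library.Z2"
    "Jordan_Normal_Form.Determinant"
begin

definition special_linear_group :: "nat \<Rightarrow> 'a::comm_ring_1 mat monoid" where
  "special_linear_group n =
     \<lparr> carrier = {A \<in> carrier_mat n n. det A = 1}, monoid.mult = (*), one = 1\<^sub>m n \<rparr>"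

definition element_centralizer :: "('a, 'b) monoid_scheme \<Rightarrow> 'a \<Rightarrow> 'a set" where
  "element_centralizer G t = {g \<in> carrier G. g \<otimes>\<^bsub>G\<^esub> t = t \<otimes>\<^bsub>G\<^esub> g}"

definition is_involution :: "('a, 'b) monoid_scheme \<Rightarrow> 'a \<Rightarrow> bool" where
  "is_involution G t \<longleftrightarrow> t \<in> carrier G \<and> group.ord G t = 2"

text \<open>The constant \<^const>\<open>group.ord\<close> is meaningful only in a group, and it is \<open>0\<close> (hence even) on
  elements of infinite order. The next two facts show that neither point matters for
  \<open>SL(n,2)\<close>.\<close>

lemma group_special_linear_group: "group (special_linear_group n :: 'a::comm_ring_1 mat monoid)"
proof (rule groupI)
  fix A :: "'a mat"
  assume "A \<in> carrier (special_linear_group n)"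
  then have A: "A \<in> carrier_mat n n" "det A = 1"
    by (auto simp: special_linear_group_def)
  let ?B = "adj_mat A"
  have B: "?B \<in> carrier_mat n n" "?B * A = 1\<^sub>m n"
    using adj_mat[OF A(1)] A(2) by auto
  have "det ?B = 1"
    using det_mult[OF B(1) A(1)] A(2) B(2) by simp
  then show "\<exists>B \<in> carrier (special_linear_group n).
      B \<otimes>\<^bsub>special_linear_group n\<^esub> A = \<one>\<^bsub>special_linear_group n\<^esub>"
    using B by (auto simp: special_linear_group_def)
qed (auto simp: special_linear_group_def det_mult)

lemma finite_special_linear_group_bit:
  "finite (carrier (special_linear_group n :: bit mat monoid))"
proof -
  have fin: "finite (UNIV :: bit set)"
    by (rule finite_subset[of _ "{0, 1}"]) (auto intro: bit.exhaust)
  let ?I = "{..<n} \<times> {..<n}"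
  let ?F = "{f :: nat \<times> nat \<Rightarrow> bit. \<forall>p. (p \<in> ?I \<longrightarrow> f p \<in> UNIV) \<and> (p \<notin> ?I \<longrightarrow> f p = 0)}"
  have "finite ?F"
    by (rule finite_set_of_finite_funs) (use fin in auto)
  moreover have "carrier (special_linear_group n :: bit mat monoid) \<subseteq> mat n n ` ?F"
  proof
    fix A :: "bit mat"
    assume "A \<in> carrier (special_linear_group n)"
    then have "A = mat n n (\<lambda>p. if p \<in> ?I then A $$ p else 0)"
      by (intro eq_matI) (auto simp: special_linear_group_def)
    then show "A \<in> mat n n ` ?F"
      by (intro image_eqI) auto
  qed
  ultimately show ?thesis
    by (meson finite_surj)
qed

end

theory Submission
  imports Defs
begin

text \<open>
  Let \<open>N\<close> be the nilpotent matrix that maps the last two standard basis vectors to the first two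
  and kills all others. Since \<open>n \<ge> 4\<close>, \<open>N\<close> squares to zero, so \<open>t = 1 + N\<close> is an involution in
  characteristic two. Commuting with \<open>t\<close> means commuting with \<open>N\<close>, and such a matrix preserves the
  image and the kernel of \<open>N\<close>; as \<open>N\<close> identifies the quotient by its kernel with its image, the
  matrix has the block form
  \<open>(a, *, * | 0, e, * | 0, 0, a)\<close>
  with the \<^emph>\<open>same\<close> two-by-two block \<open>a\<close> at both ends (\<open>commute_corner_identity\<close>).

  Let \<open>x\<close> be the permutation matrix that exchanges the first two basis vectors. Every element \<open>y\<close> of
  the coset \<open>C(t) x\<close> is then still block triangular, with the blocks \<open>a s\<close> and \<open>a\<close> at its ends,
  where \<open>s\<close> is the two-by-two swap. If \<open>y\<close> had odd order, then so would \<open>a s\<close> and \<open>a\<close>, because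
  taking a diagonal block commutes with powers. But \<open>GL(2,2)\<close> is the symmetric group on the three
  nonzero vectors: elements of odd order are even permutations, whereas \<open>s\<close> is a transposition, so
  \<open>a s\<close> and \<open>a\<close> have opposite parity. This contradiction shows that \<open>y\<close> has even order. The parity
  is an explicit quadratic form in the matrix entries (\<open>transposition_parity\<close>), which makes it
  additive by a finite check.
\<close>

section \<open>The sign on two-by-two matrices over the field with two elements\<close>

text \<open>
  On invertible matrices this is the sign character of \<open>GL(2,2)\<close>, viewed as the symmetric group on
  the three nonzero vectors and written additively: it is \<open>0\<close> on the identity and on the two elements
  of order three, and \<open>1\<close> on the three involutions.
\<close>
definition transposition_parity :: "bit mat \<Rightarrow> bit" where
  "transposition_parity A =
     A $$ (0,0) * A $$ (0,1) + A $$ (0,1) * A $$ (1,0) + A $$ (1,0) * A $$ (1,1)"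

lemma index_mult_mat_2:
  assumes "A \<in> carrier_mat 2 2" "B \<in> carrier_mat 2 2" "i < 2" "j < 2"
  shows "(A * B) $$ (i,j) = A $$ (i,0) * B $$ (0,j) + A $$ (i,1) * B $$ (1,j)"
  using assms by (simp add: scalar_prod_def numeral_2_eq_2)

lemma det_mat_2:
  fixes A :: "'a::comm_ring_1 mat"
  assumes A: "A \<in> carrier_mat 2 2"
  shows "det A = A $$ (0,0) * A $$ (1,1) - A $$ (0,1) * A $$ (1,0)"
  using laplace_expansion_column[OF A, of 0] A
  by (simp add: numeral_2_eq_2 cofactor_def det_single mat_delete_def)

text \<open>
  Additivity fails for singular matrices; the determinant hypotheses cut the sixteen matrices down to
  the six on which the form is the sign.
\<close>
lemma transposition_parity_mult:
  assumes A: "A \<in> carrier_mat 2 2" "det A = 1" and B: "B \<in> carrier_mat 2 2" "det B = 1"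
  shows "transposition_parity (A * B) = transposition_parity A + transposition_parity B"
proof -
  have table: "(a*e + b*g) * (a*f + b*h) + (a*f + b*h) * (c*e + d*g) + (c*e + d*g) * (c*f + d*h)
      = (a*b + b*c + c*d) + (e*f + f*g + g*h)"
    if "a*d - b*c = 1" "e*h - f*g = 1" for a b c d e f g h :: bit
    using that
    by (cases a; cases b; cases c; cases d; cases e; cases f; cases g; cases h) simp_all
  have "A $$ (0,0) * A $$ (1,1) - A $$ (0,1) * A $$ (1,0) = 1"
       "B $$ (0,0) * B $$ (1,1) - B $$ (0,1) * B $$ (1,0) = 1"
    using A B by (simp_all add: det_mat_2)
  from table[OF this] show ?thesis
    by (simp add: transposition_parity_def index_mult_mat_2[OF A(1) B(1)])
qed

text \<open>
  Exchanging the columns is right multiplication by a transposition of two basis vectors.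
\<close>
lemma transposition_parity_swap_columns:
  assumes A: "A \<in> carrier_mat 2 2" "det A = 1"
    and B: "B = mat 2 2 (\<lambda>(i,j). A $$ (i, 1 - j))"
  shows "transposition_parity B = transposition_parity A + 1"
proof -
  have table: "b*a + a*d + d*c = a*b + b*c + c*d + 1" if "a*d - b*c = 1" for a b c d :: bit
    using that by (cases a; cases b; cases c; cases d) simp_all
  have "A $$ (0,0) * A $$ (1,1) - A $$ (0,1) * A $$ (1,0) = 1"
    using A by (simp add: det_mat_2)
  from table[OF this] show ?thesis
    by (simp add: transposition_parity_def B)
qed

lemma odd_order_det_eq_1:
  fixes A :: "bit mat"
  assumes A: "A \<in> carrier_mat k k" and pow: "A ^\<^sub>m m = 1\<^sub>m k" and "odd m"
  shows "det A = 1"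
proof (rule ccontr)
  assume "det A \<noteq> 1"
  then have "det A = 0" by simp
  moreover have "det (A ^\<^sub>m m) = det A ^ m"
    using A by (induction m) (simp_all add: det_mult[of _ k])
  ultimately show False
    using pow \<open>odd m\<close> by (cases m) simp_all
qed

text \<open>
  A homomorphism into a group of order two is trivial on elements of odd order.
\<close>
lemma odd_order_transposition_parity_eq_0:
  assumes A: "A \<in> carrier_mat 2 2" and pow: "A ^\<^sub>m m = 1\<^sub>m 2" and "odd m"
  shows "transposition_parity A = 0"
proof -
  have det: "det A = 1"
    using assms by (rule odd_order_det_eq_1)
  have "det (A ^\<^sub>m j) = 1 \<and> transposition_parity (A ^\<^sub>m j) = of_nat j * transposition_parity A" for j
  proof (induction j)
    case 0
    then show ?case using A by (simp add: transposition_parity_def)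
  next
    case (Suc j)
    then show ?case
      using A det by (simp add: det_mult[of _ 2] transposition_parity_mult algebra_simps)
  qed
  then have "transposition_parity (A ^\<^sub>m m) = of_nat m * transposition_parity A"
    by blast
  moreover have "transposition_parity (1\<^sub>m 2) = 0"
    by (simp add: transposition_parity_def)
  moreover have "(of_nat m :: bit) = 1"
    using \<open>odd m\<close> by (auto elim!: oddE)
  ultimately show ?thesis
    using pow by simp
qed

section \<open>Diagonal blocks of powers\<close>

definition diag_block :: "nat \<Rightarrow> nat \<Rightarrow> 'a mat \<Rightarrow> 'a mat" where
  "diag_block p k A = mat k k (\<lambda>(i,j). A $$ (p + i, p + j))"

lemma diag_block_carrier [simp]: "diag_block p k A \<in> carrier_mat k k"
  by (simp add: diag_block_def)

lemma diag_block_one [simp]: "p + k \<le> n \<Longrightarrow> diag_block p k (1\<^sub>m n) = 1\<^sub>m k"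
  by (rule eq_matI) (auto simp: diag_block_def)

text \<open>
  In general a diagonal block of a product also receives contributions from indices outside the
  block. Requiring only that these cross terms vanish covers both of the ways in which block
  triangularity is used below: the first block has only zeros beneath it, the last one only zeros to
  its left.
\<close>
lemma diag_block_mult:
  fixes A B :: "'a::semiring_1 mat"
  assumes A: "A \<in> carrier_mat n n" and B: "B \<in> carrier_mat n n" and pk: "p + k \<le> n"
    and vanish: "\<And>i j l. \<lbrakk>i \<in> {p..<p+k}; j \<in> {p..<p+k}; l < n; l \<notin> {p..<p+k}\<rbrakk>
      \<Longrightarrow> A $$ (i,l) * B $$ (l,j) = 0"
  shows "diag_block p k (A * B) = diag_block p k A * diag_block p k B"
proof (rule eq_matI)
  fix i j
  assume "i < dim_row (diag_block p k A * diag_block p k B)"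
    and "j < dim_col (diag_block p k A * diag_block p k B)"
  then have ij: "i < k" "j < k" by (simp_all add: diag_block_def)
  have "diag_block p k (A * B) $$ (i,j) = (\<Sum>l\<in>{0..<n}. A $$ (p+i,l) * B $$ (l,p+j))"
    using A B pk ij by (simp add: diag_block_def scalar_prod_def)
  also have "\<dots> = (\<Sum>l\<in>{p..<p+k}. A $$ (p+i,l) * B $$ (l,p+j))"
    using pk ij by (intro sum.mono_neutral_right ballI vanish) auto
  also have "\<dots> = (\<Sum>l\<in>{0..<k}. A $$ (p+i,p+l) * B $$ (p+l,p+j))"
    using sum.shift_bounds_nat_ivl[of "\<lambda>l. A $$ (p+i,l) * B $$ (l,p+j)" 0 p k]
    by (simp add: add.commute)
  also have "\<dots> = (diag_block p k A * diag_block p k B) $$ (i,j)"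
    using ij by (simp add: diag_block_def scalar_prod_def)
  finally show "diag_block p k (A * B) $$ (i,j) = (diag_block p k A * diag_block p k B) $$ (i,j)" .
qed (simp_all add: diag_block_def)

text \<open>
  The block's columns are zero outside the block, that is, the coordinate subspace of the block is
  invariant, and its powers act on that subspace.
\<close>
lemma diag_block_pow_columns:
  fixes A :: "'a::semiring_1 mat"
  assumes A: "A \<in> carrier_mat n n" and pk: "p + k \<le> n"
    and zero: "\<And>l j. \<lbrakk>l < n; l \<notin> {p..<p+k}; j \<in> {p..<p+k}\<rbrakk> \<Longrightarrow> A $$ (l,j) = 0"
  shows "diag_block p k (A ^\<^sub>m m) = diag_block p k A ^\<^sub>m m"
proof (induction m)
  case 0
  show ?case using A pk by (simp add: diag_block_def[of p k A])
next
  case (Suc m)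
  have "diag_block p k (A ^\<^sub>m m * A) = diag_block p k (A ^\<^sub>m m) * diag_block p k A"
    by (rule diag_block_mult[OF _ A pk]) (simp_all add: A zero)
  then show ?case by (simp add: Suc)
qed

text \<open>
  Dually, the remaining coordinates span an invariant subspace, and the block is the action on the
  quotient. Only the single factor \<open>A\<close> is known to have zero rows, so it has to be split off on the
  left, against the recursion that defines powers.
\<close>
lemma diag_block_pow_rows:
  fixes A :: "'a::semiring_1 mat"
  assumes A: "A \<in> carrier_mat n n" and pk: "p + k \<le> n"
    and zero: "\<And>i l. \<lbrakk>i \<in> {p..<p+k}; l < n; l \<notin> {p..<p+k}\<rbrakk> \<Longrightarrow> A $$ (i,l) = 0"
  shows "diag_block p k (A ^\<^sub>m m) = diag_block p k A ^\<^sub>m m"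
proof (induction m)
  case 0
  show ?case using A pk by (simp add: diag_block_def[of p k A])
next
  case (Suc m)
  have comm: "B ^\<^sub>m m * B = B * B ^\<^sub>m m" if "B \<in> carrier_mat r r" for B :: "'a mat" and r
    using that by (induction m) (simp_all add: assoc_mult_mat[of _ r r _ r _ r])
  have "diag_block p k (A * A ^\<^sub>m m) = diag_block p k A * diag_block p k (A ^\<^sub>m m)"
    by (rule diag_block_mult[OF A _ pk]) (simp_all add: A zero)
  then show ?case by (simp add: Suc comm[OF A] comm[OF diag_block_carrier])
qed

section \<open>Square-zero corners and their centralizers\<close>

text \<open>
  For \<open>k \<le> n\<close>, the identity matrix of size \<open>k\<close> in the upper right corner: the bound on the column index
  forces \<open>i < k\<close> at the nonzero entries.
\<close>
definition corner_identity :: "nat \<Rightarrow> nat \<Rightarrow> 'a::semiring_1 mat" where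
  "corner_identity n k = mat n n (\<lambda>(i,j). if j = i + (n - k) then 1 else 0)"

lemma corner_identity_carrier [simp]: "corner_identity n k \<in> carrier_mat n n"
  by (simp add: corner_identity_def)

lemma mult_corner_identity:
  fixes A :: "'a::semiring_1 mat"
  assumes "A \<in> carrier_mat n n" "i < n" "j < n"
  shows "(A * corner_identity n k) $$ (i,j) = (if n - k \<le> j then A $$ (i, j - (n - k)) else 0)"
proof -
  have "(A * corner_identity n k) $$ (i,j) =
      (\<Sum>l\<in>{0..<n}. if n - k \<le> j \<and> l = j - (n - k) then A $$ (i,l) else 0)"
    using assms unfolding corner_identity_def by (auto simp: scalar_prod_def intro!: sum.cong)
  moreover have "j - (n - k) < n" using assms by simp
  ultimately show ?thesis using assms by (simp add: sum.delta)
qed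

lemma corner_identity_mult:
  fixes A :: "'a::semiring_1 mat"
  assumes "A \<in> carrier_mat n n" "k \<le> n" "i < n" "j < n"
  shows "(corner_identity n k * A) $$ (i,j) = (if i < k then A $$ (i + (n - k), j) else 0)"
proof -
  have "(corner_identity n k * A) $$ (i,j) =
      (\<Sum>l\<in>{0..<n}. if l = i + (n - k) then A $$ (l,j) else 0)"
    using assms by (simp add: corner_identity_def scalar_prod_def if_distrib[of "\<lambda>u. u * _"] cong: if_cong)
  moreover have "i + (n - k) < n \<longleftrightarrow> i < k" using assms by auto
  ultimately show ?thesis by (simp add: sum.delta)
qed

text \<open>
  Right multiplication by the corner moves the first \<open>k\<close> columns to the end, left multiplication
  moves the last \<open>k\<close> rows to the top. Comparing the two products entry by entry gives three regions:
  one where only the first is nonzero, one where only the second is, and one where they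
  overlap, which identifies the two blocks.
\<close>
lemma commute_corner_identity:
  fixes A :: "'a::semiring_1 mat"
  assumes A: "A \<in> carrier_mat n n" and k: "k \<le> n"
    and comm: "A * corner_identity n k = corner_identity n k * A"
  shows "\<And>i j. \<lbrakk>k \<le> i; i < n; j < k\<rbrakk> \<Longrightarrow> A $$ (i,j) = 0"
    and "\<And>i j. \<lbrakk>n - k \<le> i; i < n; j < n - k\<rbrakk> \<Longrightarrow> A $$ (i,j) = 0"
    and "diag_block (n - k) k A = diag_block 0 k A"
proof -
  have entry: "(if n - k \<le> j then A $$ (i, j - (n - k)) else 0) =
      (if i < k then A $$ (i + (n - k), j) else 0)" if "i < n" "j < n" for i j
    using mult_corner_identity[OF A that, of k] corner_identity_mult[OF A k that] comm by simp
  have shift: "j + (n - k) < n" if "j < k" for j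
    using that k by simp
  show "A $$ (i,j) = 0" if "k \<le> i" "i < n" "j < k" for i j
    using entry[OF that(2) shift[OF that(3)]] that unfolding diff_add_inverse2 by (auto split: if_splits)
  show "A $$ (i,j) = 0" if "n - k \<le> i" "i < n" "j < n - k" for i j
  proof -
    define r where "r = i - (n - k)"
    have r: "i = r + (n - k)" "r < k" "r < n" and j: "j < n"
      using that k by (auto simp: r_def)
    then show ?thesis
      using entry[OF r(3) j] that(3) by auto
  qed
  show "diag_block (n - k) k A = diag_block 0 k A"
  proof (rule eq_matI)
    fix i j
    assume "i < dim_row (diag_block 0 k A)" "j < dim_col (diag_block 0 k A)"
    then have ij: "i < k" "j < k" by (simp_all add: diag_block_def)
    then have "i < n" using k by simp
    from entry[OF this shift[OF ij(2)]] show "diag_block (n - k) k A $$ (i,j) = diag_block 0 k A $$ (i,j)"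
      using ij unfolding diff_add_inverse2 add.commute[of _ "n - k"] by (simp add: diag_block_def)
  qed (simp_all add: diag_block_def)
qed

lemma commute_one_plus_iff:
  fixes A N :: "'a::ring_1 mat"
  assumes A: "A \<in> carrier_mat n n" and N: "N \<in> carrier_mat n n"
  shows "A * (1\<^sub>m n + N) = (1\<^sub>m n + N) * A \<longleftrightarrow> A * N = N * A"
proof -
  have "A * (1\<^sub>m n + N) = A + A * N" "(1\<^sub>m n + N) * A = A + N * A"
    using mult_add_distrib_mat[OF A one_carrier_mat N] add_mult_distrib_mat[OF one_carrier_mat N A] A
    by simp_all
  moreover have "A + X = A + Y \<longleftrightarrow> X = Y" if "X \<in> carrier_mat n n" "Y \<in> carrier_mat n n" for X Y
  proof
    assume *: "A + X = A + Y"
    show "X = Y"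
    proof (rule eq_matI)
      fix i j assume "i < dim_row Y" "j < dim_col Y"
      moreover have "(A + X) $$ (i,j) = (A + Y) $$ (i,j)" by (simp add: *)
      ultimately show "X $$ (i,j) = Y $$ (i,j)" using that A by simp
    qed (use that in auto)
  qed simp
  ultimately show ?thesis using A N by simp
qed

lemma pow_special_linear_group:
  assumes "A \<in> carrier_mat n n"
  shows "A [^]\<^bsub>special_linear_group n\<^esub> (m::nat) = A ^\<^sub>m m"
  using assms by (induction m) (simp_all add: special_linear_group_def)

text \<open>
  The bound \<open>2 * k \<le> n\<close> makes the image of the corner lie in its kernel, so the corner squares to zero
  and \<open>(1 + N)^2 = 1 + 2 N\<close>, which is \<open>1\<close> in characteristic two.
\<close>
lemma is_involution_one_plus_corner_identity:
  assumes k: "0 < k" "2 * k \<le> n"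
  shows "is_involution (special_linear_group n) (1\<^sub>m n + corner_identity n k :: bit mat)"
proof -
  let ?G = "special_linear_group n :: bit mat monoid"
  let ?N = "corner_identity n k :: bit mat"
  let ?t = "1\<^sub>m n + ?N"
  interpret group ?G by (rule group_special_linear_group)
  have tc: "?t \<in> carrier_mat n n" by simp
  have "upper_triangular ?t"
    by (auto simp: corner_identity_def)
  then have "det ?t = prod_list (diag_mat ?t)"
    using tc by (rule det_upper_triangular)
  also have "diag_mat ?t = map (\<lambda>i. 1) [0..<n]"
    using k by (auto simp: diag_mat_def corner_identity_def)
  also have "prod_list (map (\<lambda>i. 1 :: bit) [0..<n]) = 1"
    by (induction n) simp_all
  finally have det: "det ?t = 1" .
  have tG: "?t \<in> carrier ?G"
    using tc det by (simp add: special_linear_group_def)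
  have NN: "?N * ?N = 0\<^sub>m n n"
  proof (rule eq_matI)
    fix i j assume "i < dim_row (0\<^sub>m n n :: bit mat)" "j < dim_col (0\<^sub>m n n :: bit mat)"
    then show "(?N * ?N) $$ (i,j) = (0\<^sub>m n n :: bit mat) $$ (i,j)"
      using k by (auto simp: mult_corner_identity[OF corner_identity_carrier])
        (auto simp: corner_identity_def)
  qed (simp_all add: corner_identity_def)
  have "?t * ?t = ?t + (?N + ?N * ?N)"
    using mult_add_distrib_mat[OF tc one_carrier_mat corner_identity_carrier, of k]
      add_mult_distrib_mat[OF one_carrier_mat corner_identity_carrier corner_identity_carrier, of n k k]
      right_mult_one_mat[OF tc] left_mult_one_mat[OF corner_identity_carrier, of n k]
    by metis
  also have "\<dots> = 1\<^sub>m n"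
    unfolding NN by (rule eq_matI) (simp_all add: corner_identity_def)
  finally have "?t [^]\<^bsub>?G\<^esub> (2::nat) = \<one>\<^bsub>?G\<^esub>"
    using pow_special_linear_group[OF tc, of 2] left_mult_one_mat[OF tc]
    by (simp add: numeral_2_eq_2 special_linear_group_def)
  then have "ord ?t dvd 2"
    using tG pow_eq_id by blast
  moreover have "?t $$ (0, n - k) = 1" "(1\<^sub>m n :: bit mat) $$ (0, n - k) = 0"
    using k by (simp_all add: corner_identity_def)
  then have "ord ?t \<noteq> 1"
    using ord_eq_1[OF tG] by (metis monoid.select_convs(2) special_linear_group_def zero_neq_one)
  ultimately have "ord ?t = 2"
    by (metis prime_nat_iff two_is_prime_nat)
  then show ?thesis
    using tG by (simp add: is_involution_def)
qed

section \<open>The coset\<close>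

lemma mult_swaprows_mat:
  fixes A :: "'a::semiring_1 mat"
  assumes "A \<in> carrier_mat n n" "k < n" "l < n" "i < n" "j < n"
  shows "(A * swaprows_mat n k l) $$ (i,j) = A $$ (i, transpose k l j)"
proof -
  have entry: "swaprows_mat n k l $$ (r,j) = (if r = transpose k l j then 1 else 0 :: 'a)"
    if "r < n" for r
    using that assms by (auto simp: swaprows_mat_def transpose_def)
  have "(A * swaprows_mat n k l) $$ (i,j) = (\<Sum>r\<in>{0..<n}. A $$ (i,r) * swaprows_mat n k l $$ (r,j))"
    using assms by (simp add: scalar_prod_def)
  also have "\<dots> = (\<Sum>r\<in>{0..<n}. if r = transpose k l j then A $$ (i,r) else 0)"
    by (intro sum.cong) (simp_all add: entry)
  also have "\<dots> = A $$ (i, transpose k l j)"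
    using assms by (auto simp: sum.delta transpose_def)
  finally show ?thesis .
qed

theorem proposition2p5:
  fixes n :: nat and G :: "bit mat monoid"
  defines "G \<equiv> special_linear_group n"
  assumes "n \<ge> 4"
  shows "\<exists>t. is_involution G t \<and>
    (\<exists>x \<in> carrier G. \<forall>y \<in> element_centralizer G t #>\<^bsub>G\<^esub> x. even (group.ord G y))"
proof -
  let ?N = "corner_identity n 2 :: bit mat"
  let ?t = "1\<^sub>m n + ?N" and ?x = "swaprows_mat n 0 1 :: bit mat"
  interpret group G
    unfolding G_def by (rule group_special_linear_group)
  have involution: "is_involution G ?t"
    unfolding G_def by (rule is_involution_one_plus_corner_identity) (use assms in auto)
  have xG: "?x \<in> carrier G"
    using assms det_swaprows_mat[of 0 n 1, where ?'a = bit]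
    by (simp add: G_def special_linear_group_def)
  moreover have "even (ord y)" if "y \<in> element_centralizer G ?t #>\<^bsub>G\<^esub> ?x" for y
  proof (rule ccontr)
    assume odd: "odd (ord y)"
    from that obtain c where cG: "c \<in> carrier G" and c: "c \<in> carrier_mat n n" "c * ?t = ?t * c"
      and y: "y = c * ?x"
      by (auto simp: r_coset_def element_centralizer_def G_def special_linear_group_def)
    have yG: "y \<in> carrier G"
      using m_closed[OF cG xG] by (simp add: y G_def special_linear_group_def)
    have yc: "y \<in> carrier_mat n n"
      using yG by (simp add: G_def special_linear_group_def)
    have "y [^]\<^bsub>G\<^esub> ord y = \<one>\<^bsub>G\<^esub>"
      using yG by simp
    then have pow: "y ^\<^sub>m ord y = 1\<^sub>m n"
      using pow_special_linear_group[OF yc] by (simp add: G_def special_linear_group_def)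
    have "c * ?N = ?N * c"
      using c commute_one_plus_iff[OF c(1) corner_identity_carrier] by blast
    note shape = commute_corner_identity[OF c(1) _ this]
    have entry: "y $$ (i,j) = c $$ (i, transpose 0 1 j)" if "i < n" "j < n" for i j
      unfolding y using that assms by (intro mult_swaprows_mat[OF c(1)]) auto

    \<comment> \<open>The two blocks of \<open>c\<close> agree, but only the first one meets the two exchanged columns.\<close>
    define a where "a = diag_block (n - 2) 2 c"
    have top: "diag_block 0 2 y = mat 2 2 (\<lambda>(i,j). a $$ (i, 1 - j))"
    proof (rule eq_matI)
      fix i j
      assume "i < dim_row (mat 2 2 (\<lambda>(i,j). a $$ (i, 1 - j)))"
        and "j < dim_col (mat 2 2 (\<lambda>(i,j). a $$ (i, 1 - j)))"
      then have ij: "i < 2" "j < 2" by simp_all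
      then have "transpose 0 1 j = 1 - j"
        by (auto simp: transpose_def)
      then show "diag_block 0 2 y $$ (i,j) = mat 2 2 (\<lambda>(i,j). a $$ (i, 1 - j)) $$ (i,j)"
        using ij assms shape(3) by (simp add: a_def diag_block_def entry)
    qed (simp_all add: diag_block_def)
    have bottom: "diag_block (n - 2) 2 y = a"
      using assms by (intro eq_matI) (auto simp: a_def diag_block_def entry transpose_def)

    have "diag_block 0 2 y ^\<^sub>m ord y = diag_block 0 2 (y ^\<^sub>m ord y)"
      using assms shape(1)
      by (intro diag_block_pow_columns[symmetric, OF yc]) (auto simp: entry transpose_def)
    then have "diag_block 0 2 y ^\<^sub>m ord y = 1\<^sub>m 2"
      using assms(2) by (simp add: pow)
    then have even_top: "transposition_parity (diag_block 0 2 y) = 0"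
      using odd by (intro odd_order_transposition_parity_eq_0) simp_all
    have "diag_block (n - 2) 2 y ^\<^sub>m ord y = diag_block (n - 2) 2 (y ^\<^sub>m ord y)"
      using assms shape(2)
      by (intro diag_block_pow_rows[symmetric, OF yc]) (auto simp: entry transpose_def)
    then have a_pow: "a ^\<^sub>m ord y = 1\<^sub>m 2"
      using assms(2) by (simp add: pow bottom)
    have a: "a \<in> carrier_mat 2 2" by (simp add: a_def)
    have "transposition_parity a = 0"
      using a a_pow odd by (rule odd_order_transposition_parity_eq_0)
    moreover have "transposition_parity (diag_block 0 2 y) = transposition_parity a + 1"
      using a odd_order_det_eq_1[OF a a_pow odd] top by (rule transposition_parity_swap_columns)
    ultimately show False
      using even_top by simp
  qed
  ultimately show ?thesis
    using involution by blast
qed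

end
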